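(* Let $A\in\mathbb{R}^{n\times n}$, $B\in\mathbb{R}^{n\times m}$, let $X\subseteq\mathbb{R}^n$ and $U\subseteq\mathbb{R}^m$ be convex, let $N\ge 1$ be an integer, and let $\ell:\mathbb{R}^n\times\mathbb{R}^m\to\mathbb{R}$ and $L:\mathbb{R}^n\to\mathbb{R}$ be stage and terminal costs. For a state $x_t\in\mathbb{R}^n$ consider the finite-horizon problem $P(x_t)$ in the decision variable $\mathbf{u}_t^N=(u_{0|t},\dots,u_{N-1|t})$: $$\begin{aligned}\min_{\mathbf{u}_t^N}\quad&\sum_{k=0}^{N-1}\ell(x_{k|t},u_{k|t})+L(x_{N|t})\\ \text{s.t.}\quad& x_{k+1|t}=Ax_{k|t}+Bu_{k|t},\quad x_{k|t}\in X,\ u_{k|t}\in U,\quad k=0,\dots,N-1,\\& x_{N|t}\in\mathrm{Int}\big(\mathrm{ch}\{x_{0|t},\dots,x_{N-1|t}\}\big),\\& x_{0|t}=x_t.\end{aligned}$$ Then the MPC scheme defined by these problems is recursively feasible: if $P(x_t)$ is feasible and $\mathbf{u}_t^N=(u^*_{0|t},\dots,u^*_{N-1|t})$ is an optimal solution of it, then $P(x_{t+1})$ is feasible for the successor state $x_{t+1}=Ax_t+Bu^*_{0|t}$.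
   Context: $\mathrm{ch}$ denotes convex hull and $\mathrm{Int}$ the (topological) interior in $\mathbb{R}^n$. The MPC scheme is the receding-horizon scheme: at each time $t$ the problem $P(x_t)$ is solved at the current state $x_t$ and the first element $u^*_{0|t}$ of the optimal input sequence is applied to $x^+=Ax+Bu$. Recursive feasibility means that feasibility at time $t$ ensures feasibility at time $t+1$ under the applied control. Feasible means that the constraint set of the problem is nonempty. *)

theory Defs
  imports "HOL-Analysis.Analysis"
begin

primrec trajectory ::
  "real^'n^'n \<Rightarrow> real^'m^'n \<Rightarrow> real^'n \<Rightarrow> (nat \<Rightarrow> real^'m) \<Rightarrow> nat \<Rightarrow> real^'n"
where
  "trajectory A B x u 0 = x"
| "trajectory A B x u (Suc k) = A *v trajectory A B x u k + B *v u k"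

text \<open>
  An input sequence of length \<open>N\<close> is an extensional function on \<open>{..<N}\<close>, so
  that the decision variable ranges over exactly the \<open>N\<close>-tuples of inputs.
\<close>

definition feasible_inputs ::
  "real^'n^'n \<Rightarrow> real^'m^'n \<Rightarrow> (real^'n) set \<Rightarrow> (real^'m) set \<Rightarrow> nat \<Rightarrow> real^'n
    \<Rightarrow> (nat \<Rightarrow> real^'m) set"
where
  "feasible_inputs A B X U N x =
    {u \<in> {..<N} \<rightarrow>\<^sub>E U.
      (\<forall>k<N. trajectory A B x u k \<in> X) \<and>
      trajectory A B x u N \<in> interior (convex hull (trajectory A B x u ` {..<N}))}"

definition horizon_cost ::
  "real^'n^'n \<Rightarrow> real^'m^'n \<Rightarrow> (real^'n \<Rightarrow> real^'m \<Rightarrow> real) \<Rightarrow> (real^'n \<Rightarrow> real) \<Rightarrow> nat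
    \<Rightarrow> real^'n \<Rightarrow> (nat \<Rightarrow> real^'m) \<Rightarrow> real"
where
  "horizon_cost A B l L N x u =
    (\<Sum>k<N. l (trajectory A B x u k) (u k)) + L (trajectory A B x u N)"

definition feasible ::
  "real^'n^'n \<Rightarrow> real^'m^'n \<Rightarrow> (real^'n) set \<Rightarrow> (real^'m) set \<Rightarrow> nat \<Rightarrow> real^'n \<Rightarrow> bool"
where
  "feasible A B X U N x \<longleftrightarrow> feasible_inputs A B X U N x \<noteq> {}"

definition optimal_solution ::
  "real^'n^'n \<Rightarrow> real^'m^'n \<Rightarrow> (real^'n) set \<Rightarrow> (real^'m) set
    \<Rightarrow> (real^'n \<Rightarrow> real^'m \<Rightarrow> real) \<Rightarrow> (real^'n \<Rightarrow> real) \<Rightarrow> nat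
    \<Rightarrow> real^'n \<Rightarrow> (nat \<Rightarrow> real^'m) \<Rightarrow> bool"
where
  "optimal_solution A B X U l L N x u \<longleftrightarrow>
    is_arg_min (horizon_cost A B l L N x) (\<lambda>v. v \<in> feasible_inputs A B X U N x) u"

end

theory Submission
  imports Defs
begin

text \<open>
  A point in the interior of the convex hull of \<open>x\<^sub>0, \<dots>, x\<^sub>N\<^sub>-\<^sub>1\<close> is a convex combination
  \<open>x\<^sub>N = \<Sum>k<N. c\<^sub>k x\<^sub>k\<close> with all \<open>c\<^sub>k > 0\<close>. The new last input is \<open>\<Sum>k<N. c\<^sub>k u\<^sub>k\<close>,
  so that by linearity \<open>x\<^sub>N\<^sub>+\<^sub>1 = \<Sum>k<N. c\<^sub>k x\<^sub>k\<^sub>+\<^sub>1\<close> lies in the relative interior of the hull of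
  \<open>x\<^sub>1, \<dots>, x\<^sub>N\<close>. As \<open>c\<^sub>0 \<noteq> 0\<close>, the point \<open>x\<^sub>0\<close> is an affine combination of
  \<open>x\<^sub>1, \<dots>, x\<^sub>N\<close>, whose affine hull is therefore still the whole space.
\<close>

text \<open>The set is the hull of a union of singletons \<open>{f i}\<close>. Weights are indexed
  by \<open>I\<close>, not by points, so that repeated values of \<open>f\<close>, such as revisited
  states, are covered.\<close>

lemma rel_interior_convex_hull_image:
  fixes f :: "'a \<Rightarrow> 'b::euclidean_space"
  assumes "finite I"
  shows "rel_interior (convex hull (f ` I)) =
    {\<Sum>i\<in>I. c i *\<^sub>R f i | c. (\<forall>i\<in>I. c i > 0) \<and> sum c I = 1}" (is "_ = ?R")
proof -
  have "(\<Union>i\<in>I. {f i}) = f ` I" by auto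
  then have "rel_interior (convex hull (f ` I)) =
    {\<Sum>i\<in>I. c i *\<^sub>R s i | c s. (\<forall>i\<in>I. c i > 0) \<and> sum c I = 1 \<and> (\<forall>i\<in>I. s i = f i)}"
    using rel_interior_convex_hull_union[of I "\<lambda>i. {f i}"] assms by simp
  also have "\<dots> = ?R"
  proof (intro equalityI subsetI)
    fix y assume "y \<in> {\<Sum>i\<in>I. c i *\<^sub>R s i | c s.
      (\<forall>i\<in>I. c i > 0) \<and> sum c I = 1 \<and> (\<forall>i\<in>I. s i = f i)}"
    then obtain c s where "\<forall>i\<in>I. c i > 0" "sum c I = 1" "\<forall>i\<in>I. s i = f i"
      and y: "y = (\<Sum>i\<in>I. c i *\<^sub>R s i)" by blast
    moreover from this have "y = (\<Sum>i\<in>I. c i *\<^sub>R f i)" by (simp cong: sum.cong)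
    ultimately show "y \<in> ?R" by blast
  qed blast
  finally show ?thesis .
qed

text \<open>The differences \<open>f i - p\<close> weighted by \<open>c i\<close> sum to zero. As
  \<open>c j \<noteq> 0\<close>, this can be solved for \<open>f j - p\<close> inside the direction
  space of the affine hull.\<close>

lemma affine_hull_exchange:
  fixes f :: "'a \<Rightarrow> 'b::real_vector"
  assumes "finite I" "j \<in> I" "sum c I = 1" "c j \<noteq> 0"
  defines "p \<equiv> \<Sum>i\<in>I. c i *\<^sub>R f i"
  shows "f j \<in> affine hull (insert p (f ` (I - {j})))" (is "_ \<in> ?H")
proof -
  have p: "p \<in> ?H" by (simp add: hull_inc)
  have sub: "subspace ((\<lambda>x. x - p) ` ?H)"
    using p by (simp add: affine_diffs_subspace_subtract)
  have "(\<Sum>i\<in>I. c i *\<^sub>R (f i - p)) = 0"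
    using assms(3) by (simp add: p_def scaleR_diff_right sum_subtractf flip: scaleR_sum_left)
  then have "c j *\<^sub>R (f j - p) = - (\<Sum>i\<in>I - {j}. c i *\<^sub>R (f i - p))"
    using assms(1,2) by (simp add: sum.remove eq_neg_iff_add_eq_0)
  also have "\<dots> \<in> (\<lambda>x. x - p) ` ?H"
    by (intro subspace_neg[OF sub] subspace_sum[OF sub] subspace_scale[OF sub] imageI hull_inc) auto
  finally have "inverse (c j) *\<^sub>R c j *\<^sub>R (f j - p) \<in> (\<lambda>x. x - p) ` ?H"
    by (rule subspace_scale[OF sub])
  then show ?thesis using assms(4) by auto
qed

lemma trajectory_linear_combination:
  assumes "w = (\<Sum>k\<in>I. c k *\<^sub>R u k)"
    and "y = (\<Sum>k\<in>I. c k *\<^sub>R trajectory A B x u k)"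
  shows "A *v y + B *v w = (\<Sum>k\<in>I. c k *\<^sub>R trajectory A B x u (Suc k))"
  using assms
  by (simp add: linear_sum[OF matrix_vector_mul_linear] matrix_vector_mult_scaleR
      scaleR_add_right sum.distrib)

lemma trajectory_shift:
  assumes "\<And>i. i < k \<Longrightarrow> v i = u (Suc i)"
  shows "trajectory A B (A *v x + B *v u 0) v k = trajectory A B x u (Suc k)"
  using assms by (induction k) auto

lemma feasible_successor:
  fixes A :: "real^'n^'n" and B :: "real^'m^'n"
  assumes "convex X" "convex U" and u: "u \<in> feasible_inputs A B X U N x"
  shows "feasible A B X U N (A *v x + B *v u 0)"
proof -
  define z where "z = trajectory A B x u"
  have uU: "u k \<in> U" and zX: "z k \<in> X" if "k < N" for k
    using u that by (auto simp: feasible_inputs_def z_def)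
  have zN: "z N \<in> interior (convex hull (z ` {..<N}))"
    using u by (simp add: feasible_inputs_def z_def)
  then have "z N \<in> rel_interior (convex hull (z ` {..<N}))"
    using interior_subset_rel_interior by blast
  then obtain c where c: "\<forall>k<N. c k > 0" "sum c {..<N} = 1" "z N = (\<Sum>k<N. c k *\<^sub>R z k)"
    by (auto simp: rel_interior_convex_hull_image)
  from c(2) have "N > 0" by (cases N) auto
  then obtain M where M: "N = Suc M" by (cases N) auto
  define w where "w = (\<Sum>k<N. c k *\<^sub>R u k)"
  have "w \<in> U" unfolding w_def
    using c by (intro convex_sum \<open>convex U\<close>) (auto simp: uU less_imp_le)
  \<comment> \<open>Feasibility constrains only the states before \<open>z N\<close>, but
    \<open>z N\<close> becomes the state \<open>y M\<close> of the new trajectory.\<close>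
  have "z N \<in> X" unfolding c(3)
    using c by (intro convex_sum \<open>convex X\<close>) (auto simp: zX less_imp_le)
  define v where "v = (\<lambda>k\<in>{..<N}. if k < M then u (Suc k) else w)"
  define y where "y = trajectory A B (A *v x + B *v u 0) v"
  \<comment> \<open>Reaching \<open>y k\<close> uses inputs with index below
    \<open>k \<le> M\<close> only, so \<open>w\<close>, placed at index \<open>M\<close>, does not
    enter yet.\<close>
  have y: "y k = z (Suc k)" if "k < N" for k
    unfolding y_def z_def using that by (intro trajectory_shift) (auto simp: v_def M)
  have "y N = A *v z N + B *v w"
    using y[of M] by (simp add: y_def M v_def)
  also have "\<dots> = (\<Sum>k<N. c k *\<^sub>R z (Suc k))"
    unfolding z_def using w_def c(3) by (intro trajectory_linear_combination) (simp_all add: z_def)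
  finally have "y N = (\<Sum>k<N. c k *\<^sub>R y k)"
    by (simp add: y)
  then have yN: "y N \<in> rel_interior (convex hull (y ` {..<N}))"
    using c by (auto simp: rel_interior_convex_hull_image)
  let ?H = "affine hull (y ` {..<N})"
  have tail: "z k \<in> ?H" if "0 < k" "k \<le> N" for k
  proof -
    have "z k = y (k - 1)" "k - 1 < N" using that by (auto simp: y)
    then show ?thesis by (simp add: hull_inc)
  qed
  \<comment> \<open>\<open>z 0\<close> is the only old state missing from \<open>y\<close>; the
    exchange recovers it from \<open>z N\<close> and the other states, all in \<open>?H\<close> by
    \<open>tail\<close>.\<close>
  have "z 0 \<in> affine hull (insert (z N) (z ` ({..<N} - {0})))"
    using affine_hull_exchange[of "{..<N}" 0 c z] c \<open>N > 0\<close> by fastforce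
  also have "\<dots> \<subseteq> ?H"
    using \<open>N > 0\<close> by (intro hull_minimal) (auto intro: tail)
  finally have "z ` {..<N} \<subseteq> ?H"
    using tail by (metis gr0I image_subsetI lessThan_iff less_imp_le)
  then have "convex hull (z ` {..<N}) \<subseteq> ?H"
    by (intro hull_minimal) (auto simp: affine_imp_convex)
  \<comment> \<open>An affine set with nonempty interior is the whole space, and then relative
    interior and interior of the new hull agree.\<close>
  with zN have "interior ?H \<noteq> {}"
    using interior_mono by blast
  then have "?H = UNIV"
    using affine_hull_nonempty_interior by fastforce
  then have "y N \<in> interior (convex hull (y ` {..<N}))"
    using yN by (simp add: rel_interior_interior)
  moreover have "v \<in> {..<N} \<rightarrow>\<^sub>E U"
    using uU \<open>w \<in> U\<close> by (auto simp: v_def M)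
  moreover have "y k \<in> X" if "k < N" for k
    using that zX \<open>z N \<in> X\<close> by (cases "Suc k = N") (auto simp: y)
  ultimately have "v \<in> feasible_inputs A B X U N (A *v x + B *v u 0)"
    by (simp add: feasible_inputs_def y_def)
  then show ?thesis by (auto simp: feasible_def)
qed

theorem proposition5:
  fixes A :: "real^'n^'n" and B :: "real^'m^'n"
    and X :: "(real^'n) set" and U :: "(real^'m) set"
    and N :: nat
    and l :: "real^'n \<Rightarrow> real^'m \<Rightarrow> real" and L :: "real^'n \<Rightarrow> real"
    and x :: "real^'n" and u :: "nat \<Rightarrow> real^'m"
  assumes "convex X" and "convex U" and "N \<ge> 1"
    and "feasible A B X U N x"
    and "optimal_solution A B X U l L N x u"
  shows "feasible A B X U N (A *v x + B *v u 0)"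
  using assms feasible_successor by (auto simp: optimal_solution_def is_arg_min_def)

end
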